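(* Let $n\ge 1$ be an integer and let $\alpha_i,\beta_i,\gamma_i$ ($i=1,\dots,n$) be real numbers with $\min(\alpha_i,\gamma_i)\ge 1$ and $\beta_i>0$ for all $i=1,\dots,n$, and with $\alpha_j+\beta_j\ge 2$ for some $j\in\{1,\dots,n\}$. Let $$\mathcal{F}(z)=\sum_{m=0}^{\infty}\frac{z^{m}}{\prod_{i=1}^{n}[\Gamma(\alpha_i m+\beta_i)]^{\gamma_i}},\qquad \mathbb{N}(z)=\prod_{i=1}^{n}[\Gamma(\alpha_i+\beta_i)]^{\gamma_i}\left[\mathcal{F}(z)-\frac{1}{\prod_{i=1}^{n}[\Gamma(\beta_i)]^{\gamma_i}}\right].$$ Then $\mathbb{N}$ is close-to-convex with respect to the starlike function $-\log(1-z)$ in $\mathcal{D}=\{z\in\mathbb{C}:|z|<1\}$, and consequently it is univalent in $\mathcal{D}$.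
   Context: $\Gamma$ is the Euler gamma function and $\log$ is the principal branch. $\mathcal{A}$ is the class of analytic functions $f$ on $\mathcal{D}$ with $f(0)=f'(0)-1=0$. A function $f\in\mathcal{A}$ is starlike in $\mathcal{D}$ if $\operatorname{Re}\left(\frac{zf'(z)}{f(z)}\right)>0$ for all $z\in\mathcal{D}$ (the quotient being $1$ at $z=0$). A function $g\in\mathcal{A}$ is close-to-convex in $\mathcal{D}$ if there is a function $h$, starlike in $\mathcal{D}$, such that $\operatorname{Re}\left(\frac{zg'(z)}{h(z)}\right)>0$ for all $z\in\mathcal{D}$ (quotient taken by continuity at $z=0$); it is then called close-to-convex with respect to the starlike function $h$. *)

theory Defs
  imports "HOL-Complex_Analysis.Complex_Analysis"
begin

abbreviation unit_disc :: "complex set" where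
  "unit_disc \<equiv> ball 0 1"

definition class_A :: "(complex \<Rightarrow> complex) set" where
  "class_A = {f. f analytic_on unit_disc \<and> f 0 = 0 \<and> deriv f 0 = 1}"

text \<open>
  A zero of \<open>f\<close> away from the origin violates the condition below, since division by zero
  gives \<open>0\<close>, whose real part is not positive. The same remark applies to zeros of \<open>h\<close> in
  \<open>close_to_convex_wrt\<close>.
\<close>

definition starlike_fun :: "(complex \<Rightarrow> complex) \<Rightarrow> bool" where
  "starlike_fun f \<longleftrightarrow> f \<in> class_A \<and>
     (\<forall>z\<in>unit_disc. Re (if z = 0 then 1 else z * deriv f z / f z) > 0)"

definition close_to_convex_wrt :: "(complex \<Rightarrow> complex) \<Rightarrow> (complex \<Rightarrow> complex) \<Rightarrow> bool" where
  "close_to_convex_wrt g h \<longleftrightarrow> g \<in> class_A \<and> starlike_fun h \<and>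
     (\<forall>z\<in>unit_disc. Re (if z = 0 then Lim (at 0) (\<lambda>w. w * deriv g w / h w)
                        else z * deriv g z / h z) > 0)"

definition univalent_on :: "(complex \<Rightarrow> complex) \<Rightarrow> complex set \<Rightarrow> bool" where
  "univalent_on f S \<longleftrightarrow> f analytic_on S \<and> inj_on f S"

text \<open>
  The parameter families are indexed by \<open>{1..n}\<close>. For \<open>\<alpha> i \<ge> 1\<close> and \<open>\<beta> i > 0\<close> all
  Gamma values below are positive reals, so \<open>powr\<close> is the ordinary real power.
\<close>

definition gen_F ::
    "nat \<Rightarrow> (nat \<Rightarrow> real) \<Rightarrow> (nat \<Rightarrow> real) \<Rightarrow> (nat \<Rightarrow> real) \<Rightarrow> complex \<Rightarrow> complex" where
  "gen_F n \<alpha> \<beta> \<gamma> z =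
     (\<Sum>m. z ^ m / of_real (\<Prod>i=1..n. Gamma (\<alpha> i * real m + \<beta> i) powr \<gamma> i))"

definition normalized_F ::
    "nat \<Rightarrow> (nat \<Rightarrow> real) \<Rightarrow> (nat \<Rightarrow> real) \<Rightarrow> (nat \<Rightarrow> real) \<Rightarrow> complex \<Rightarrow> complex" where
  "normalized_F n \<alpha> \<beta> \<gamma> z =
     of_real (\<Prod>i=1..n. Gamma (\<alpha> i + \<beta> i) powr \<gamma> i) *
     (gen_F n \<alpha> \<beta> \<gamma> z - 1 / of_real (\<Prod>i=1..n. Gamma (\<beta> i) powr \<gamma> i))"

end

theory Submission
  imports Defs
begin

text \<open>
  Write \<open>g\<close> for the function in question, \<open>h z = - Ln (1 - z)\<close> and \<open>g' z = \<Sum>k. p k * z ^ k\<close>, with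
  \<open>p 0 = 1\<close>. Since \<open>\<Gamma> (x + a) \<ge> x * \<Gamma> x\<close> for \<open>x, a \<ge> 1\<close>, no factor of the denominators decreases
  from the index 1 on, and a factor with \<open>\<alpha> j + \<beta> j \<ge> 2\<close> grows at least like the factorial
  (\<open>prod_Gamma_powr_growth\<close>). Hence \<open>0 \<le> (k + 1) * p (k + 1) \<le> p k\<close>: the coefficients of \<open>g'\<close> decay
  at least as fast as those of the exponential series. Only this decay is used afterwards, in two
  ways.

  \<^item> The coefficients decrease, so \<open>Re ((1 - z) * g' z) > 0\<close>
    (\<open>Re_one_minus_times_powser_decseq_pos\<close>). This is the classical coefficient criterion of Ozaki.

  \<^item> The series \<open>g'\<close> is a convex combination of the exponential function and its Taylor polynomials,
    each of which has positive real part in the disc; so \<open>Re (g' z) > 0\<close>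
    (\<open>Re_powser_factorial_decay_pos\<close>).

  Each inequality is one endpoint of an interpolation. With \<open>w = Ln (1 - z)\<close>,
  \<open>z / h z = (exp w - 1) / w\<close> is the integral of \<open>(1 - z)\<^sup>s\<close> over \<open>s \<in> [0, 1]\<close>,
  and the argument of \<open>(1 - z)\<^sup>s * g' z\<close> is affine in \<open>s\<close>. It lies in \<open>(-\<pi>/2, \<pi>/2)\<close> at \<open>s = 0\<close> by the second
  inequality and at \<open>s = 1\<close> by the first, hence for all \<open>s\<close> in between, and so
  \<open>Re (z * g' z / h z) > 0\<close> (\<open>Re_mult_exp_difference_quotient_pos\<close>).

  That \<open>h\<close> is starlike is a further instance of the first inequality, for the decreasing coefficients
  \<open>1 / (k + 1)\<close> of \<open>h z / z\<close>.

  Univalence comes from \<open>Re ((1 - z) * g' z) > 0\<close> alone. The map \<open>h\<close> sends the disc onto a convex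
  region, and \<open>(1 - z) * g' z\<close> is the derivative of \<open>g\<close> in the coordinate \<open>h\<close>. A holomorphic function
  on a convex region whose derivative has positive real part is injective
  (\<open>inj_on_disc_if_Re_one_minus_mult_deriv_pos\<close>).
\<close>

section \<open>Power series with decreasing coefficients\<close>

lemma summable_powser_decseq:
  fixes p :: "nat \<Rightarrow> real" and z :: complex
  assumes "decseq p" "\<And>k. p k \<ge> 0" "norm z < 1"
  shows "summable (\<lambda>k. of_real (p k) * z ^ k)"
proof (rule summable_comparison_test')
  show "summable (\<lambda>k. p 0 * norm z ^ k)"
    using assms(3) by (intro summable_mult summable_geometric) auto
  show "norm (of_real (p k) * z ^ k) \<le> p 0 * norm z ^ k" for k
    using assms(2)[of k] decseqD[OF assms(1), of 0 k]
    by (auto simp: norm_mult norm_power intro!: mult_right_mono)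
qed

text \<open>
  Multiplying by \<open>1 - z\<close> turns the coefficients into \<open>p 0\<close> followed by the negatives of the
  differences \<open>p k - p (k + 1)\<close>. These differences are nonnegative and telescope to a sum of at most \<open>p 0\<close>, so the
  nonconstant part has modulus at most \<open>p 0 * norm z < p 0\<close>.
\<close>

lemma Re_one_minus_times_powser_decseq_pos:
  fixes p :: "nat \<Rightarrow> real" and z :: complex
  assumes dec: "decseq p" and nonneg: "\<And>k. p k \<ge> 0" and pos: "p 0 > 0" and z: "norm z < 1"
  shows "Re ((1 - z) * (\<Sum>k. of_real (p k) * z ^ k)) > 0"
proof -
  obtain L where L: "p \<longlonglongrightarrow> L"
    using decseq_convergent[OF dec, of 0] nonneg by metis
  have L0: "L \<ge> 0"
    using L nonneg by (intro LIMSEQ_le_const[OF L]) auto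
  define d where "d k = p k - p (Suc k)" for k
  have d0: "d k \<ge> 0" for k
    using dec by (simp add: d_def decseq_Suc_iff)
  have d_sums: "d sums (p 0 - L)"
    unfolding d_def by (rule telescope_sums'[OF L])
  define S where "S = (\<Sum>k. of_real (p k) * z ^ k)"
  have S: "(\<lambda>k. of_real (p k) * z ^ k) sums S"
    unfolding S_def using summable_powser_decseq[OF dec nonneg z] by (rule summable_sums)
  have shift: "(\<lambda>k. of_real (p (Suc k)) * z ^ Suc k) sums (S - p 0)"
    using S by (subst sums_Suc_iff) simp
  have "(\<lambda>k. of_real (p k) * z ^ k * z - of_real (p (Suc k)) * z ^ Suc k) sums (S * z - (S - p 0))"
    by (intro sums_diff sums_mult2 S shift)
  also have "(\<lambda>k. of_real (p k) * z ^ k * z - of_real (p (Suc k)) * z ^ Suc k)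
             = (\<lambda>k. of_real (d k) * z ^ Suc k)"
    by (simp add: d_def algebra_simps)
  finally have T: "(\<lambda>k. of_real (d k) * z ^ Suc k) sums (p 0 - (1 - z) * S)"
    by (simp add: algebra_simps)
  have bound: "norm (of_real (d k) * z ^ Suc k) \<le> d k * norm z" for k
  proof -
    have "norm z ^ Suc k \<le> norm z"
      using z by (simp add: mult_left_le power_le_one)
    thus ?thesis
      using d0[of k] by (simp add: norm_mult norm_power mult_left_mono del: power_Suc)
  qed
  have sums': "(\<lambda>k. d k * norm z) sums ((p 0 - L) * norm z)"
    by (intro sums_mult2 d_sums)
  have "norm (p 0 - (1 - z) * S) \<le> (p 0 - L) * norm z"
    using norm_suminf_le[OF bound sums_summable[OF sums']] sums_unique[OF sums'] sums_unique[OF T]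
    by simp
  also have "\<dots> \<le> p 0 * norm z"
    using L0 by (intro mult_right_mono) auto
  also have "\<dots> < p 0"
    using pos z by simp
  finally have "Re (p 0 - (1 - z) * S) < p 0"
    using complex_Re_le_cmod order_le_less_trans by blast
  thus ?thesis
    by (simp add: S_def)
qed

text \<open>
  For \<open>z = x + \<i> * y\<close> the left-hand side of the conclusion is \<open>Re (1 + z + z\<^sup>2 / 2)\<close>. The lower bound
  \<open>1 / 4\<close> is what pays for the tail of the exponential series below, since that tail
  \<open>1 / 3! + 1 / 4! + \<dots>\<close> is at most \<open>2 / 9\<close>.
\<close>

lemma Re_quadratic_exp_ge:
  fixes x y :: real
  assumes "x\<^sup>2 + y\<^sup>2 \<le> 1"
  shows "1 + x + (x\<^sup>2 - y\<^sup>2) / 2 \<ge> 1 / 4"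
proof -
  have "0 \<le> (x + 1 / 2)\<^sup>2" by simp
  also have "(x + 1 / 2)\<^sup>2 = x\<^sup>2 + x + 1 / 4" by (simp add: power2_eq_square algebra_simps)
  finally show ?thesis using assms by (simp add: field_simps)
qed

lemma decseq_if_factorial_decay:
  fixes p :: "nat \<Rightarrow> real"
  assumes nonneg: "\<And>k. p k \<ge> 0" and decay: "\<And>k. real (Suc k) * p (Suc k) \<le> p k"
  shows "decseq p"
proof (rule decseq_SucI)
  fix k
  have "1 * p (Suc k) \<le> real (Suc k) * p (Suc k)"
    using nonneg[of "Suc k"] by (intro mult_right_mono) auto
  thus "p (Suc k) \<le> p k" using decay[of k] by linarith
qed

text \<open>
  Put \<open>c k = k! * p k\<close>. Then \<open>1 = c 0 \<ge> c 1 \<ge> c 2 \<ge> \<dots> \<ge> 0\<close>, and summation by parts writes the series as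
  a convex combination of the Taylor polynomials of the exponential function and, in the limit, the
  function itself. The polynomials of degree 0, 1 and 2 are treated exactly, because \<open>Re (1 + z)\<close> has no
  positive lower bound on the disc. From degree 3 on, the terms are estimated by their moduli: they contribute at
  most \<open>2 / 9 * c 2\<close>, while the quadratic polynomial contributes at least \<open>1 / 4 * c 2\<close>.
\<close>

lemma Re_powser_factorial_decay_pos:
  fixes p :: "nat \<Rightarrow> real" and z :: complex
  assumes p0: "p 0 = 1" and nonneg: "\<And>k. p k \<ge> 0"
    and decay: "\<And>k. real (Suc k) * p (Suc k) \<le> p k" and z: "norm z < 1"
  shows "Re (\<Sum>k. of_real (p k) * z ^ k) > 0"
proof -
  have dec: "decseq p"
    using nonneg decay by (rule decseq_if_factorial_decay)
  have tail: "p (k + 3) \<le> p 2 / 3 * (1 / 4) ^ k" for k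
  proof (induction k)
    case 0
    show ?case using decay[of 2] by (simp add: eval_nat_numeral)
  next
    case (Suc k)
    have "4 * p (Suc k + 3) \<le> real (Suc (k + 3)) * p (Suc (k + 3))"
      using nonneg[of "Suc (k + 3)"] by (auto intro!: mult_right_mono)
    also have "\<dots> \<le> p (k + 3)" by (rule decay)
    finally show ?case using Suc by simp
  qed
  have summ: "summable (\<lambda>k. of_real (p k) * z ^ k)"
    by (rule summable_powser_decseq[OF dec nonneg z])
  define R where "R = (\<Sum>k. of_real (p (k + 3)) * z ^ (k + 3))"
  have split: "(\<Sum>k. of_real (p k) * z ^ k) = 1 + of_real (p 1) * z + of_real (p 2) * z ^ 2 + R"
    using suminf_split_initial_segment[OF summ, of 3] p0
    by (simp add: R_def eval_nat_numeral)
  have geo: "(\<lambda>k. p 2 / 3 * (1 / 4) ^ k) sums (p 2 / 3 * (1 / (1 - 1 / 4 :: real)))"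
    by (intro sums_mult geometric_sums) auto
  have termle: "norm (of_real (p (k + 3)) * z ^ (k + 3)) \<le> p 2 / 3 * (1 / 4) ^ k" for k
  proof -
    have "norm z ^ (k + 3) \<le> 1"
      using z by (intro power_le_one) auto
    hence "p (k + 3) * norm z ^ (k + 3) \<le> p (k + 3) * 1"
      by (intro mult_left_mono nonneg)
    thus ?thesis using tail[of k] nonneg[of "k + 3"] by (simp add: norm_mult norm_power)
  qed
  have "norm R \<le> p 2 * 4 / 9"
    unfolding R_def using norm_suminf_le[OF termle sums_summable[OF geo]] sums_unique[OF geo] by simp
  hence R: "Re R \<ge> - (p 2 * 4 / 9)"
    using abs_Re_le_cmod[of R] by linarith
  define x y where "x = Re z" and "y = Im z"
  have xy: "x\<^sup>2 + y\<^sup>2 < 1"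
    using z power_strict_mono[of "norm z" 1 2] by (simp add: cmod_power2 x_def y_def)
  have x: "1 + x > 0"
    using z abs_Re_le_cmod[of z] by (simp add: x_def)
  have main: "Re (\<Sum>k. of_real (p k) * z ^ k) = 1 + p 1 * x + p 2 * (x\<^sup>2 - y\<^sup>2) + Re R"
    by (simp add: split x_def y_def power2_eq_square)
  have c1: "p 1 \<le> 1" "2 * p 2 \<le> p 1"
    using decay[of 0] decay[of 1] p0 by (simp_all add: eval_nat_numeral)
  \<comment> \<open>Abel summation: with \<open>c\<^sub>1 = p 1\<close> and \<open>c\<^sub>2 = 2 * p 2\<close>, the quadratic part is a combination of the
      partial sums \<open>1\<close>, \<open>1 + z\<close> and \<open>1 + z + z\<^sup>2/2\<close> with the weights
      \<open>1 - c\<^sub>1\<close>, \<open>c\<^sub>1 - c\<^sub>2\<close> and \<open>c\<^sub>2\<close>.\<close>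
  have abel: "1 + p 1 * x + p 2 * (x\<^sup>2 - y\<^sup>2)
      = (1 - p 1) + (p 1 - 2 * p 2) * (1 + x) + 2 * p 2 * (1 + x + (x\<^sup>2 - y\<^sup>2) / 2)"
    by (simp add: field_simps)
  have "2 * p 2 * (1 + x + (x\<^sup>2 - y\<^sup>2) / 2) \<ge> 2 * p 2 * (1 / 4)"
    using Re_quadratic_exp_ge[of x y] xy nonneg[of 2] by (intro mult_left_mono) auto
  moreover have mid: "(p 1 - 2 * p 2) * (1 + x) \<ge> 0"
    using c1 x by simp
  ultimately have lower: "Re (\<Sum>k. of_real (p k) * z ^ k)
      \<ge> (1 - p 1) + (p 1 - 2 * p 2) * (1 + x) + p 2 / 18"
    unfolding main abel using R by linarith
  show ?thesis
  proof (cases "p 2 = 0")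
    case False
    thus ?thesis using lower mid c1 nonneg[of 2] by linarith
  next
    case True
    have "(1 - p 1) + p 1 * (1 + x) > 0"
    proof (cases "p 1 = 0")
      case False
      hence "p 1 * (1 + x) > 0" using nonneg[of 1] x by simp
      thus ?thesis using c1 by linarith
    qed simp
    thus ?thesis using lower True by simp
  qed
qed

section \<open>The function \<open>- Ln (1 - z)\<close>\<close>

lemma one_minus_in_disc:
  assumes "z \<in> unit_disc"
  shows "Re (1 - z) > 0" "1 - z \<noteq> 0" "1 - z \<notin> \<real>\<^sub>\<le>\<^sub>0"
proof -
  show *: "Re (1 - z) > 0"
    using assms complex_Re_le_cmod[of z] by (simp add: dist_norm)
  show "1 - z \<noteq> 0" "1 - z \<notin> \<real>\<^sub>\<le>\<^sub>0"
    using * by (auto simp: complex_nonpos_Reals_iff)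
qed

lemma has_field_derivative_neg_Ln_one_minus:
  assumes "z \<in> unit_disc"
  shows "((\<lambda>z. - Ln (1 - z)) has_field_derivative 1 / (1 - z)) (at z)"
  using one_minus_in_disc[OF assms]
  by (auto intro!: derivative_eq_intros simp: divide_simps)

lemma Ln_one_minus_nonzero:
  assumes "z \<in> unit_disc" "z \<noteq> 0"
  shows "Ln (1 - z) \<noteq> 0"
  using one_minus_in_disc[OF assms(1)] assms(2) exp_Ln[of "1 - z"] by force

lemma neg_Ln_one_minus_eq_powser:
  assumes "z \<in> unit_disc"
  shows "- Ln (1 - z) = z * (\<Sum>k. of_real (1 / real (Suc k)) * z ^ k)"
proof -
  have "(\<lambda>n. - (z ^ n) / of_nat n) sums Ln (1 - z)"
    using Ln_series'[of "- z"] assms by (simp add: dist_norm)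
  from sums_minus[OF this] have "(\<lambda>n. z ^ n / of_nat n) sums (- Ln (1 - z))"
    by simp
  hence "(\<lambda>n. z ^ Suc n / of_nat (Suc n)) sums (- Ln (1 - z))"
    by (subst sums_Suc_iff) simp
  hence 1: "(\<lambda>k. z * (of_real (1 / real (Suc k)) * z ^ k)) sums (- Ln (1 - z))"
    by (simp add: field_simps del: of_nat_Suc)
  have "summable (\<lambda>k. of_real (1 / real (Suc k)) * z ^ k)"
    using assms by (intro summable_powser_decseq) (auto simp: decseq_def frac_le dist_norm)
  from sums_mult[OF summable_sums[OF this], of z] 1 show ?thesis
    using sums_unique2 by blast
qed

text \<open>
  The reciprocal of \<open>z * h' z / h z\<close> for \<open>h z = - Ln (1 - z)\<close> is \<open>(1 - z) * h z / z\<close>, and \<open>h z / z\<close> is a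
  power series with decreasing coefficients. Taking reciprocals preserves the sign of the real part.
\<close>

lemma starlike_neg_Ln_one_minus: "starlike_fun (\<lambda>z. - Ln (1 - z))"
  unfolding starlike_fun_def class_A_def
proof safe
  have "(\<lambda>z. - Ln (1 - z)) holomorphic_on unit_disc"
    using one_minus_in_disc by (intro holomorphic_intros) auto
  thus "(\<lambda>z. - Ln (1 - z)) analytic_on unit_disc"
    by (simp add: analytic_on_open)
  show "deriv (\<lambda>z. - Ln (1 - z)) 0 = 1"
    using DERIV_imp_deriv[OF has_field_derivative_neg_Ln_one_minus[of 0]] by simp
  show "- Ln (1 - 0) = 0" by simp
next
  fix z assume z: "z \<in> unit_disc"
  show "0 < Re (if z = 0 then 1 else z * deriv (\<lambda>z. - Ln (1 - z)) z / (- Ln (1 - z)))"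
  proof (cases "z = 0")
    case False
    define S where "S = (\<Sum>k. of_real (1 / real (Suc k)) * z ^ k)"
    have "z * deriv (\<lambda>z. - Ln (1 - z)) z / (- Ln (1 - z)) = inverse ((1 - z) * S)"
      unfolding DERIV_imp_deriv[OF has_field_derivative_neg_Ln_one_minus[OF z]]
        neg_Ln_one_minus_eq_powser[OF z] S_def[symmetric]
      using False by (simp add: inverse_eq_divide)
    moreover have "Re ((1 - z) * S) > 0"
      unfolding S_def using z
      by (intro Re_one_minus_times_powser_decseq_pos) (auto simp: decseq_def frac_le dist_norm)
    ultimately show ?thesis
      using False by (simp add: inverse_eq_divide Re_complex_div_gt_0)
  qed simp
qed

section \<open>Interpolating the argument\<close>

lemma cos_gt_zero_imp_abs_less_half_pi:
  assumes "cos x > 0" "\<bar>x\<bar> < pi"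
  shows "\<bar>x\<bar> < pi / 2"
proof (rule ccontr)
  assume "\<not> \<bar>x\<bar> < pi / 2"
  hence "cos \<bar>x\<bar> \<le> cos (pi / 2)"
    using assms(2) by (intro cos_monotone_0_pi_le) auto
  thus False using assms(1) by simp
qed

text \<open>
  Along \<open>s \<in> [0, 1]\<close> the quantity \<open>Im (Ln P) + s * Im w\<close> is an argument of \<open>P * exp (s * w)\<close>, affine
  in \<open>s\<close>. The bound on \<open>Im w\<close> keeps it in \<open>(-\<pi>, \<pi>)\<close> at \<open>s = 1\<close>, so that a positive real part there means
  that this argument itself, and not merely a translate by a multiple of \<open>2 * \<pi>\<close>, lies in
  \<open>(-\<pi>/2, \<pi>/2)\<close>.
\<close>

lemma Re_mult_exp_interpolation_pos:
  assumes P: "Re P > 0" and Pw: "Re (P * exp w) > 0" and w: "\<bar>Im w\<bar> < pi / 2"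
    and s: "0 \<le> s" "s \<le> 1"
  shows "Re (P * exp (of_real s * w)) > 0"
proof -
  define \<phi> where "\<phi> = Im (Ln P)"
  have "P \<noteq> 0" using P by auto
  hence polar: "P * exp u = exp (Ln P + u)" for u
    by (simp add: exp_add)
  have \<phi>: "\<bar>\<phi>\<bar> < pi / 2"
    unfolding \<phi>_def by (rule Re_Ln_pos_lt_imp[OF P])
  have "cos (\<phi> + Im w) > 0"
    using Pw unfolding polar by (simp add: Re_exp \<phi>_def zero_less_mult_iff)
  hence end1: "\<bar>\<phi> + Im w\<bar> < pi / 2"
    using \<phi> w by (intro cos_gt_zero_imp_abs_less_half_pi) auto
  have "\<phi> + s * Im w = (1 - s) * \<phi> + s * (\<phi> + Im w)"
    by (simp add: algebra_simps)
  also have "\<bar>\<dots>\<bar> \<le> (1 - s) * \<bar>\<phi>\<bar> + s * \<bar>\<phi> + Im w\<bar>"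
    using s by (intro order.trans[OF abs_triangle_ineq]) (simp add: abs_mult)
  also have "\<dots> < pi / 2"
    using s \<phi> end1 by (intro convex_bound_lt) auto
  finally have "cos (\<phi> + s * Im w) > 0"
    by (intro cos_gt_zero_pi) linarith+
  thus ?thesis
    unfolding polar by (simp add: Re_exp \<phi>_def)
qed

text \<open>
  The quotient \<open>(exp w - 1) / w\<close> is the mean of \<open>exp (s * w)\<close> over \<open>s \<in> [0, 1]\<close>. The mean value theorem
  for real parts replaces the integral: it gives a single \<open>s\<close> at which the real part of
  \<open>P * exp (s * w)\<close> equals that of \<open>P * (exp w - 1) / w\<close>.
\<close>

lemma Re_mult_exp_difference_quotient_pos:
  assumes "Re P > 0" "Re (P * exp w) > 0" "\<bar>Im w\<bar> < pi / 2" "w \<noteq> 0"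
  shows "Re (P * (exp w - 1) / w) > 0"
proof -
  have "\<exists>u. u \<in> closed_segment 0 w \<and>
      Re (P * exp w / w) - Re (P * exp 0 / w) = Re (P * exp u / w * (w - 0))"
    by (rule complex_mvt_line) (auto intro!: derivative_eq_intros simp: assms(4))
  then obtain s where s: "0 \<le> s" "s \<le> 1"
    and eq: "Re (P * exp w / w) - Re (P / w) = Re (P * exp (of_real s * w))"
    using assms(4) by (auto simp: closed_segment_def scaleR_conv_of_real)
  have "P * (exp w - 1) / w = P * exp w / w - P / w"
    by (simp add: algebra_simps diff_divide_distrib)
  thus ?thesis
    using eq Re_mult_exp_interpolation_pos[OF assms(1-3) s] by simp
qed

section \<open>Convexity of the logarithmic image and univalence\<close>

lemma cmod_one_minus_exp_less_1_iff:
  assumes "\<bar>Im w\<bar> < pi / 2"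
  shows "cmod (1 - exp w) < 1 \<longleftrightarrow> Re w < ln 2 + ln (cos (Im w))"
proof -
  define r c where "r = exp (Re w)" and "c = cos (Im w)"
  have r: "r > 0" and c: "c > 0"
    using assms by (auto simp: r_def c_def intro!: cos_gt_zero_pi)
  have "(cmod (1 - exp w))\<^sup>2 = (1 - r * c)\<^sup>2 + (r * sin (Im w))\<^sup>2"
    unfolding cmod_power2 by (simp add: Re_exp Im_exp r_def c_def)
  also have "\<dots> = 1 + r * (r * (c\<^sup>2 + (sin (Im w))\<^sup>2) - 2 * c)"
    by (simp add: power2_eq_square algebra_simps)
  also have "c\<^sup>2 + (sin (Im w))\<^sup>2 = 1"
    by (simp add: c_def)
  finally have sq: "(cmod (1 - exp w))\<^sup>2 = 1 + r * (r - 2 * c)" by simp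
  have "cmod (1 - exp w) < 1 \<longleftrightarrow> (cmod (1 - exp w))\<^sup>2 < 1"
    using abs_square_less_1[of "cmod (1 - exp w)"] by simp
  also have "\<dots> \<longleftrightarrow> r < 2 * c"
    using r unfolding sq by (auto simp: mult_less_0_iff)
  also have "\<dots> \<longleftrightarrow> ln r < ln (2 * c)"
    using r c by simp
  also have "ln (2 * c) = ln 2 + ln c"
    using c by (simp add: ln_mult)
  finally show ?thesis by (simp add: r_def c_def)
qed

lemma concave_on_ln_cos: "concave_on {- (pi / 2)<..<pi / 2} (\<lambda>x. ln (cos x))"
proof (rule f''_le0_imp_concave)
  fix x :: real assume "x \<in> {- (pi / 2)<..<pi / 2}"
  hence x: "cos x > 0" by (intro cos_gt_zero_pi) auto
  show "((\<lambda>x. ln (cos x)) has_real_derivative - tan x) (at x)"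
    using x by (auto intro!: derivative_eq_intros simp: tan_def)
  show "((\<lambda>x. - tan x) has_real_derivative - inverse ((cos x)\<^sup>2)) (at x)"
    using x by (auto intro!: derivative_eq_intros)
  show "- inverse ((cos x)\<^sup>2) \<le> 0" by simp
qed simp

text \<open>
  The set is the image of the disc of radius 1 around 1 under the principal logarithm, that is, the
  reflection of the image of the unit disc under \<open>- Ln (1 - z)\<close>. By
  \<open>cmod_one_minus_exp_less_1_iff\<close> it is the part of a strip to the left of the graph of a concave function of
  \<open>Im w\<close>, and hence convex.
\<close>

lemma convex_log_image_of_disc: "convex {w. \<bar>Im w\<bar> < pi / 2 \<and> cmod (1 - exp w) < 1}"
proof (rule convexI, safe)
  fix v w :: complex and s t :: real
  assume v: "\<bar>Im v\<bar> < pi / 2" "cmod (1 - exp v) < 1"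
    and w: "\<bar>Im w\<bar> < pi / 2" "cmod (1 - exp w) < 1"
    and st: "0 \<le> s" "0 \<le> t" "s + t = 1"
  let ?u = "s *\<^sub>R v + t *\<^sub>R w"
  let ?I = "{- (pi / 2)<..<pi / 2}"
  have I: "Im v \<in> ?I" "Im w \<in> ?I" using v(1) w(1) by auto
  have "s *\<^sub>R Im v + t *\<^sub>R Im w \<in> ?I"
    using I st by (intro convexD) auto
  hence "- (pi / 2) < Im ?u" "Im ?u < pi / 2" by auto
  hence Im_u: "\<bar>Im ?u\<bar> < pi / 2" by linarith
  thus "\<bar>Im ?u\<bar> < pi / 2" .
  have s: "s = 1 - t" using st by simp
  have "s * ln (cos (Im v)) + t * ln (cos (Im w)) \<le> ln (cos (Im ?u))"
    using concave_onD[OF concave_on_ln_cos, of t "Im v" "Im w"] I st by (simp add: s)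
  moreover have "s * (Re v - ln 2 - ln (cos (Im v))) + t * (Re w - ln 2 - ln (cos (Im w))) < 0"
    using v w st cmod_one_minus_exp_less_1_iff[OF v(1)] cmod_one_minus_exp_less_1_iff[OF w(1)]
    by (intro convex_bound_lt) auto
  moreover have "s * (Re v - ln 2 - ln (cos (Im v))) + t * (Re w - ln 2 - ln (cos (Im w)))
      = Re ?u - ln 2 - (s * ln (cos (Im v)) + t * ln (cos (Im w)))"
    by (simp add: s algebra_simps)
  ultimately show "cmod (1 - exp ?u) < 1"
    unfolding cmod_one_minus_exp_less_1_iff[OF Im_u] by linarith
qed

text \<open>
  The Noshiro--Warschawski argument in the coordinate \<open>u = Ln (1 - z)\<close>, in which the disc becomes
  convex and the derivative of \<open>f\<close> becomes \<open>- (1 - z) * f' z\<close>, with real part of constant sign. If \<open>f\<close>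
  took equal values at two points, the mean value theorem on the segment joining their coordinates
  would give a point where this real part vanishes.
\<close>

lemma inj_on_disc_if_Re_one_minus_mult_deriv_pos:
  assumes f: "\<And>z. z \<in> unit_disc \<Longrightarrow> (f has_field_derivative f' z) (at z)"
    and pos: "\<And>z. z \<in> unit_disc \<Longrightarrow> Re ((1 - z) * f' z) > 0"
  shows "inj_on f unit_disc"
proof (rule inj_onI, rule ccontr)
  fix a b assume ab: "a \<in> unit_disc" "b \<in> unit_disc" "f a = f b" "a \<noteq> b"
  define T where "T = {w. \<bar>Im w\<bar> < pi / 2 \<and> cmod (1 - exp w) < 1}"
  define v w where "v = Ln (1 - a)" and "w = Ln (1 - b)"
  have vw: "exp v = 1 - a" "exp w = 1 - b"
    using one_minus_in_disc(2) ab by (auto simp: v_def w_def)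
  have "v \<in> T" "w \<in> T"
    using ab vw Re_Ln_pos_lt_imp[OF one_minus_in_disc(1)]
    by (auto simp: T_def v_def w_def dist_norm)
  hence seg: "closed_segment v w \<subseteq> T"
    using convex_log_image_of_disc by (simp add: T_def closed_segment_subset)
  have "v \<noteq> w" using vw ab by auto
  \<comment> \<open>Dividing by \<open>w - v\<close> first makes the mean value theorem speak of the real part of the derivative
      alone, without the direction of the segment.\<close>
  have "\<exists>u. u \<in> closed_segment v w \<and>
      Re (f (1 - exp w) / (w - v)) - Re (f (1 - exp v) / (w - v)) =
      Re (- (f' (1 - exp u) * exp u) / (w - v) * (w - v))"
  proof (rule complex_mvt_line)
    fix u assume "u \<in> closed_segment v w"
    hence "1 - exp u \<in> unit_disc" using seg by (auto simp: T_def dist_norm norm_minus_commute)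
    from f[OF this]
    have "((\<lambda>u. f (1 - exp u)) has_field_derivative f' (1 - exp u) * - exp u) (at u)"
      by (rule DERIV_chain2) (auto intro!: derivative_eq_intros)
    from DERIV_cdivide[OF this, of "w - v"]
    show "((\<lambda>u. f (1 - exp u) / (w - v)) has_field_derivative
        - (f' (1 - exp u) * exp u) / (w - v)) (at u)" by simp
  qed
  then obtain u where u: "u \<in> closed_segment v w" and "Re (f' (1 - exp u) * exp u) = 0"
    using vw ab(3) \<open>v \<noteq> w\<close> by auto
  moreover have "1 - exp u \<in> unit_disc" using u seg by (auto simp: T_def dist_norm norm_minus_commute)
  from pos[OF this] have "Re (f' (1 - exp u) * exp u) > 0" by (simp add: mult.commute)
  ultimately show False by simp
qed

section \<open>A criterion for close-to-convexity\<close>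

text \<open>
  The condition \<open>Re ((1 - z) * f' z) > 0\<close> compares \<open>f'\<close> with the derivative of \<open>- Ln (1 - z)\<close>, whereas
  close-to-convexity as defined here compares \<open>z * f' z\<close> with \<open>- Ln (1 - z)\<close> itself. The additional
  condition \<open>Re (f' z) > 0\<close> makes the passage between the two possible by interpolation.
\<close>

lemma close_to_convex_and_univalent_criterion:
  assumes f: "\<And>z. z \<in> unit_disc \<Longrightarrow> (f has_field_derivative f' z) (at z)"
    and f0: "f 0 = 0" and f'0: "f' 0 = 1"
    and pos0: "\<And>z. z \<in> unit_disc \<Longrightarrow> Re (f' z) > 0"
    and pos1: "\<And>z. z \<in> unit_disc \<Longrightarrow> Re ((1 - z) * f' z) > 0"
  shows "close_to_convex_wrt f (\<lambda>z. - Ln (1 - z)) \<and> univalent_on f unit_disc"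
proof -
  have deriv: "deriv f z = f' z" if "z \<in> unit_disc" for z
    using f[OF that] by (rule DERIV_imp_deriv)
  have "f holomorphic_on unit_disc"
    using f by (meson field_differentiable_at_within field_differentiable_def holomorphic_on_def)
  hence an: "f analytic_on unit_disc"
    by (simp add: analytic_on_open)
  have "deriv f holomorphic_on unit_disc"
    using \<open>f holomorphic_on unit_disc\<close> by (intro holomorphic_deriv) auto
  hence "isCont (deriv f) 0"
    using continuous_on_eq_continuous_at[OF open_ball] holomorphic_on_imp_continuous_on by force
  hence "(deriv f \<longlongrightarrow> 1) (at 0)"
    using deriv[of 0] f'0 by (simp add: isCont_def)
  moreover have "((\<lambda>w. - Ln (1 - w) / w) \<longlongrightarrow> 1) (at 0)"
    using has_field_derivative_neg_Ln_one_minus[of 0] by (simp add: has_field_derivative_iff)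
  ultimately have "((\<lambda>w. deriv f w / (- Ln (1 - w) / w)) \<longlongrightarrow> 1 / 1) (at 0)"
    by (intro tendsto_divide) auto
  hence "((\<lambda>w. w * deriv f w / (- Ln (1 - w))) \<longlongrightarrow> 1) (at 0)"
    by (simp add: mult.commute)
  hence lim: "Lim (at 0) (\<lambda>w. w * deriv f w / (- Ln (1 - w))) = 1"
    by (intro tendsto_Lim) auto
  have "Re (z * deriv f z / (- Ln (1 - z))) > 0" if z: "z \<in> unit_disc" "z \<noteq> 0" for z
  proof -
    define w where "w = Ln (1 - z)"
    have w: "exp w = 1 - z" "\<bar>Im w\<bar> < pi / 2" "w \<noteq> 0"
      using one_minus_in_disc[OF z(1)] Re_Ln_pos_lt_imp Ln_one_minus_nonzero[OF z]
      by (auto simp: w_def)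
    have "Re (f' z * (exp w - 1) / w) > 0"
      using pos0[OF z(1)] pos1[OF z(1)] w
      by (intro Re_mult_exp_difference_quotient_pos) (auto simp: mult.commute)
    moreover have "f' z * (exp w - 1) / w = z * deriv f z / (- Ln (1 - z))"
      using w by (simp add: deriv[OF z(1)] flip: w_def)
    ultimately show ?thesis by simp
  qed
  hence "close_to_convex_wrt f (\<lambda>z. - Ln (1 - z))"
    unfolding close_to_convex_wrt_def class_A_def
    using an f0 f'0 deriv[of 0] lim starlike_neg_Ln_one_minus by auto
  moreover have "inj_on f unit_disc"
    using f pos1 by (rule inj_on_disc_if_Re_one_minus_mult_deriv_pos)
  ultimately show ?thesis
    using an by (simp add: univalent_on_def)
qed

section \<open>The coefficients\<close>

text \<open>
  The Gamma function increases on \<open>[3/2, \<infinity>)\<close>, which contains \<open>x + 1\<close>; so the shift \<open>a\<close> may be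
  replaced by 1, where the functional equation applies.
\<close>

lemma Gamma_add_ge:
  fixes x a :: real
  assumes "x \<ge> 1" "a \<ge> 1"
  shows "x * Gamma x \<le> Gamma (x + a)"
proof -
  have "x \<notin> \<int>\<^sub>\<le>\<^sub>0" using assms by (auto elim!: nonpos_Ints_cases)
  hence "x * Gamma x = Gamma (x + 1)" by (rule Gamma_plus1[symmetric])
  also have "\<dots> \<le> Gamma (x + a)"
    using Gamma_real_strict_mono[of "x + 1" "x + a"] assms by (cases "a = 1") auto
  finally show ?thesis .
qed

lemma Gamma_powr_growth:
  fixes x a c :: real
  assumes "x \<ge> 1" "a \<ge> 1" "c \<ge> 1"
  shows "x * Gamma x powr c \<le> Gamma (x + a) powr c"
proof -
  have "x * Gamma x powr c \<le> x powr c * Gamma x powr c"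
    using powr_mono[of 1 c x] assms by (intro mult_right_mono) auto
  also have "\<dots> = (x * Gamma x) powr c"
    using assms by (simp add: powr_mult)
  also have "\<dots> \<le> Gamma (x + a) powr c"
    using Gamma_add_ge[of x a] assms by (intro powr_mono2) auto
  finally show ?thesis .
qed

text \<open>
  The \<open>i\<close>-th factor grows at least by the factor \<open>x i = \<alpha> i * m + \<beta> i\<close>, which is at least 1. For the
  index \<open>j\<close>, writing \<open>x j = \<alpha> j * (m - 1) + (\<alpha> j + \<beta> j)\<close> shows \<open>x j \<ge> m + 1\<close>.
\<close>

lemma prod_Gamma_powr_growth:
  fixes \<alpha> \<beta> \<gamma> :: "'a \<Rightarrow> real"
  assumes fin: "finite I" and m: "m \<ge> 1"
    and par: "\<And>i. i \<in> I \<Longrightarrow> \<alpha> i \<ge> 1 \<and> \<gamma> i \<ge> 1 \<and> \<beta> i > 0"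
    and j: "j \<in> I" "\<alpha> j + \<beta> j \<ge> 2"
  shows "real (Suc m) * (\<Prod>i\<in>I. Gamma (\<alpha> i * real m + \<beta> i) powr \<gamma> i)
         \<le> (\<Prod>i\<in>I. Gamma (\<alpha> i * real (Suc m) + \<beta> i) powr \<gamma> i)"
proof -
  define x where "x i = \<alpha> i * real m + \<beta> i" for i
  have am: "\<alpha> i * real m \<ge> 1" if "i \<in> I" for i
    using par[OF that] m mult_mono[of 1 "\<alpha> i" 1 "real m"] by simp
  have x1: "x i \<ge> 1" if "i \<in> I" for i
    using am[OF that] par[OF that] by (simp add: x_def)
  have "1 * (real m - 1) \<le> \<alpha> j * (real m - 1)"
    using par[OF j(1)] m by (intro mult_right_mono) auto
  hence xj: "x j \<ge> real (Suc m)"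
    using j(2) by (simp add: x_def algebra_simps)
  have "real (Suc m) \<le> (\<Prod>i\<in>I. x i)"
  proof -
    have "real (Suc m) * 1 \<le> x j * (\<Prod>i\<in>I - {j}. x i)"
      using xj x1 j(1) by (intro mult_mono prod_ge_1) auto
    thus ?thesis using prod.remove[OF fin j(1), of x] by simp
  qed
  hence "real (Suc m) * (\<Prod>i\<in>I. Gamma (x i) powr \<gamma> i) \<le> (\<Prod>i\<in>I. x i) * (\<Prod>i\<in>I. Gamma (x i) powr \<gamma> i)"
    by (intro mult_right_mono prod_nonneg) auto
  also have "\<dots> = (\<Prod>i\<in>I. x i * Gamma (x i) powr \<gamma> i)"
    by (simp add: prod.distrib)
  also have "\<dots> \<le> (\<Prod>i\<in>I. Gamma (x i + \<alpha> i) powr \<gamma> i)"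
    using x1 par by (intro prod_mono conjI Gamma_powr_growth mult_nonneg_nonneg)
      (force intro: order.trans[OF zero_le_one])+
  also have "\<dots> = (\<Prod>i\<in>I. Gamma (\<alpha> i * real (Suc m) + \<beta> i) powr \<gamma> i)"
    by (simp add: x_def algebra_simps)
  finally show ?thesis by (simp add: x_def)
qed

theorem theorem5:
  fixes n :: nat and \<alpha> \<beta> \<gamma> :: "nat \<Rightarrow> real"
  assumes "n \<ge> 1"
    and "\<forall>i\<in>{1..n}. min (\<alpha> i) (\<gamma> i) \<ge> 1 \<and> \<beta> i > 0"
    and "\<exists>j\<in>{1..n}. \<alpha> j + \<beta> j \<ge> 2"
  shows "close_to_convex_wrt (normalized_F n \<alpha> \<beta> \<gamma>) (\<lambda>z. - Ln (1 - z)) \<and>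
         univalent_on (normalized_F n \<alpha> \<beta> \<gamma>) unit_disc"
proof -
  define C where "C m = (\<Prod>i=1..n. Gamma (\<alpha> i * real m + \<beta> i) powr \<gamma> i)" for m
  define p where "p k = real (Suc k) * C 1 / C (Suc k)" for k
  have C_pos: "C m > 0" for m
    unfolding C_def
  proof (rule prod_pos)
    fix i assume "i \<in> {1..n}"
    hence "min (\<alpha> i) (\<gamma> i) \<ge> 1" "\<beta> i > 0" using assms(2) by blast+
    hence "\<alpha> i \<ge> 0" "\<beta> i > 0" by linarith+
    hence "\<alpha> i * real m + \<beta> i > 0"
      by (intro add_nonneg_pos mult_nonneg_nonneg) auto
    thus "Gamma (\<alpha> i * real m + \<beta> i) powr \<gamma> i > 0"
      using Gamma_real_pos by (simp add: order_less_imp_not_eq2)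
  qed
  have C_growth: "real (Suc m) * C m \<le> C (Suc m)" if "m \<ge> 1" for m
  proof -
    from assms(3) obtain j where j: "j \<in> {1..n}" "\<alpha> j + \<beta> j \<ge> 2" by blast
    thus ?thesis
      unfolding C_def using that assms(2) by (intro prod_Gamma_powr_growth[of _ _ _ _ _ j]) auto
  qed
  have p0: "p 0 = 1" using C_pos[of 1] by (simp add: p_def)
  have p_nonneg: "p k \<ge> 0" for k
    using C_pos[of 1] C_pos[of "Suc k"] by (simp add: p_def)
  have decay: "real (Suc k) * p (Suc k) \<le> p k" for k
  proof -
    have "real (Suc (Suc k)) / C (Suc (Suc k)) \<le> 1 / C (Suc k)"
      using C_growth[of "Suc k"] C_pos[of "Suc k"] C_pos[of "Suc (Suc k)"]
      by (simp add: divide_simps mult.commute)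
    hence "(real (Suc k) * C 1) * (real (Suc (Suc k)) / C (Suc (Suc k)))
           \<le> (real (Suc k) * C 1) * (1 / C (Suc k))"
      using C_pos[of 1] by (intro mult_left_mono) auto
    thus ?thesis by (simp add: p_def mult_ac)
  qed
  have dec: "decseq p"
    using p_nonneg decay by (rule decseq_if_factorial_decay)
  \<comment> \<open>The coefficients of the normalized function; its derivative has the coefficients \<open>p k\<close>. The
      value at \<open>m = 0\<close> reflects the subtraction of the constant term of the series.\<close>
  define c where "c m = (if m = 0 then 0 else complex_of_real (C 1 / C m))" for m
  have diffs: "diffs c k = of_real (p k)" for k
    by (simp add: diffs_def c_def p_def)
  have c_le_1: "norm (c m) \<le> 1" for m
  proof (cases m)
    case (Suc k)
    have "c m = of_real (p k) / of_nat (Suc k)"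
      by (simp add: c_def p_def Suc del: of_nat_Suc)
    also have "norm \<dots> \<le> 1 / 1"
      unfolding norm_divide using p_nonneg[of k] decseqD[OF dec, of 0 k] p0
      by (intro frac_le) (auto simp del: of_nat_Suc simp: norm_of_nat)
    finally show ?thesis by simp
  qed (simp add: c_def)
  have summ_c: "summable (\<lambda>m. c m * z ^ m)" if "norm z < 1" for z
    by (rule summable_comparison_test'[OF summable_geometric[of "norm z"]])
      (use that c_le_1 in \<open>auto simp: norm_mult norm_power intro: mult_left_le_one_le\<close>)
  have F_eq: "normalized_F n \<alpha> \<beta> \<gamma> z = (\<Sum>m. c m * z ^ m)" if z: "norm z < 1" for z
  proof -
    have "(\<lambda>m. (if m = 0 then of_real (C 1 / C 0) else 0) + c m * z ^ m) sums
        (of_real (C 1 / C 0) + (\<Sum>m. c m * z ^ m))"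
      by (intro sums_add summable_sums[OF summ_c[OF z]] sums_single)
    hence "(\<lambda>m. inverse (of_real (C 1)) * ((if m = 0 then of_real (C 1 / C 0) else 0) + c m * z ^ m))
        sums (inverse (of_real (C 1)) * (of_real (C 1 / C 0) + (\<Sum>m. c m * z ^ m)))"
      by (rule sums_mult)
    moreover have "inverse (of_real (C 1)) * ((if m = 0 then of_real (C 1 / C 0) else 0) + c m * z ^ m)
        = z ^ m / of_real (C m)" for m
      using C_pos[of 1] by (auto simp: c_def field_simps)
    ultimately have "gen_F n \<alpha> \<beta> \<gamma> z
        = inverse (of_real (C 1)) * (of_real (C 1 / C 0) + (\<Sum>m. c m * z ^ m))"
      unfolding gen_F_def C_def[symmetric] by (simp add: sums_iff)
    moreover have "normalized_F n \<alpha> \<beta> \<gamma> z = of_real (C 1) * (gen_F n \<alpha> \<beta> \<gamma> z - 1 / of_real (C 0))"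
      by (simp add: normalized_F_def C_def)
    ultimately show ?thesis
      using C_pos[of 1] by (simp add: field_simps)
  qed
  show ?thesis
  proof (rule close_to_convex_and_univalent_criterion)
    fix z :: complex assume z: "z \<in> unit_disc"
    have "((\<lambda>z. \<Sum>m. c m * z ^ m) has_field_derivative (\<Sum>k. diffs c k * z ^ k)) (at z)"
      using summ_c z by (intro termdiffs_strong'[of 1]) (auto simp: dist_norm)
    moreover have "eventually (\<lambda>z. z \<in> unit_disc) (nhds z)"
      using z by (intro eventually_nhds_in_open) auto
    hence "eventually (\<lambda>z. normalized_F n \<alpha> \<beta> \<gamma> z = (\<Sum>m. c m * z ^ m)) (nhds z)"
      by eventually_elim (simp add: F_eq dist_norm)
    ultimately show "(normalized_F n \<alpha> \<beta> \<gamma> has_field_derivative (\<Sum>k. of_real (p k) * z ^ k)) (at z)"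
      unfolding diffs by (subst DERIV_cong_ev[OF refl _ refl]) auto
    show "Re (\<Sum>k. of_real (p k) * z ^ k) > 0"
      using z by (intro Re_powser_factorial_decay_pos p0 p_nonneg decay) (auto simp: dist_norm)
    show "Re ((1 - z) * (\<Sum>k. of_real (p k) * z ^ k)) > 0"
      using z p0 by (intro Re_one_minus_times_powser_decseq_pos dec p_nonneg) (auto simp: dist_norm)
  next
    show "normalized_F n \<alpha> \<beta> \<gamma> 0 = 0"
      by (simp add: F_eq c_def powser_zero)
    show "(\<Sum>k. of_real (p k) * 0 ^ k) = (1 :: complex)"
      by (simp add: powser_zero p0)
  qed
qed

end
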